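(* Let $\xi(t)$, $t\in\mathbb{R}$, be a stationary continuous time process with finite second moment and correlation function $b(t)$. Then $\xi(t)$ is stable if and only if $$\lim_{T\to\infty}\frac{2}{T}\int_0^T\left(1-\frac{t}{T}\right)|b(t)|^2\,dt=0.$$ Otherwise, $$\lim_{T\to\infty}\frac{2}{T}\int_0^T\left(1-\frac{t}{T}\right)|b(t)|^2\,dt=\sum_\alpha m_\alpha^2,$$ where $\{m_\alpha\}$ is the set of jumps of the spectral distribution function $\vartheta$ of the process.
   Context: The correlation function $b$ of the process is a continuous Hermitian positive (i.e. positive definite) function on $\mathbb{R}$ and admits the representation $$b(t)=\int_{-\infty}^{\infty}e^{i\lambda t}\,d\vartheta(\lambda),$$ where the spectral distribution function $\vartheta$ is a bounded non-decreasing function on the real axis. The process is called stable if $\vartheta$ is continuous, and unstable otherwise. The $m_\alpha=\vartheta(\lambda_\alpha+0)-\vartheta(\lambda_\alpha-0)$ are the jumps of $\vartheta$ at its (at most countably many) discontinuity points $\lambda_\alpha$, listed one for each discontinuity point. *)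

theory Defs
  imports "HOL-Probability.Probability"
begin

text \<open>The second moments below are not centred: a process with non-zero mean is covered by
  them directly, and its covariance function is the correlation function of the centred
  process.  Stationarity is meant in the wide sense; a strictly stationary process with finite
  second moment is stationary in this sense.\<close>

definition correlation_function :: "'w measure \<Rightarrow> (real \<Rightarrow> 'w \<Rightarrow> complex) \<Rightarrow> real \<Rightarrow> complex" where
  "correlation_function M \<xi> t = (LINT \<omega>|M. \<xi> t \<omega> * cnj (\<xi> 0 \<omega>))"

definition stationary_process :: "'w measure \<Rightarrow> (real \<Rightarrow> 'w \<Rightarrow> complex) \<Rightarrow> bool" where
  "stationary_process M \<xi> \<longleftrightarrow>
     prob_space M \<and>
     (\<forall>t. \<xi> t \<in> borel_measurable M) \<and>
     (\<forall>t. integrable M (\<lambda>\<omega>. (cmod (\<xi> t \<omega>))\<^sup>2)) \<and>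
     (\<forall>t. (LINT \<omega>|M. \<xi> t \<omega>) = (LINT \<omega>|M. \<xi> 0 \<omega>)) \<and>
     (\<forall>s t. (LINT \<omega>|M. \<xi> (s + t) \<omega> * cnj (\<xi> s \<omega>)) = correlation_function M \<xi> t)"

text \<open>A non-decreasing function is not assumed to be normalised at its discontinuities.  Since
  \<^const>\<open>interval_measure\<close> is only meaningful for right-continuous functions, the measure
  $d\vartheta$ is the interval measure of the right-continuous version $\vartheta(x+0)$.\<close>

definition stieltjes_measure :: "(real \<Rightarrow> real) \<Rightarrow> real measure" where
  "stieltjes_measure \<theta> = interval_measure (\<lambda>x. Lim (at_right x) \<theta>)"

definition jump :: "(real \<Rightarrow> real) \<Rightarrow> real \<Rightarrow> real" where
  "jump \<theta> x = Lim (at_right x) \<theta> - Lim (at_left x) \<theta>"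

definition discontinuities :: "(real \<Rightarrow> real) \<Rightarrow> real set" where
  "discontinuities \<theta> = {x. \<not> isCont \<theta> x}"

definition spectral_distribution_function ::
    "'w measure \<Rightarrow> (real \<Rightarrow> 'w \<Rightarrow> complex) \<Rightarrow> (real \<Rightarrow> real) \<Rightarrow> bool" where
  "spectral_distribution_function M \<xi> \<theta> \<longleftrightarrow>
     mono \<theta> \<and> bounded (range \<theta>) \<and>
     (\<forall>t. correlation_function M \<xi> t = (LINT x|stieltjes_measure \<theta>. exp (\<i> * of_real (x * t))))"

text \<open>The spectral distribution function is determined by the process up to an additive constant
  and up to its values at its discontinuities, so that its continuity does not depend on the
  choice made here.\<close>

definition stable_process :: "'w measure \<Rightarrow> (real \<Rightarrow> 'w \<Rightarrow> complex) \<Rightarrow> bool" where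
  "stable_process M \<xi> \<longleftrightarrow>
     (\<exists>\<theta>. spectral_distribution_function M \<xi> \<theta> \<and> continuous_on UNIV \<theta>)"

end

theory Submission
  imports Defs
begin

text \<open>This is Wiener's theorem on the atoms of a finite measure, applied to the spectral measure
  $\mu = d\vartheta$.  As $b$ is the Fourier transform of $\mu$, its squared modulus is the
  Fourier transform of $\mu \otimes \mu$ along the difference of the two coordinates,
  $$|b(t)|^2 = \int\!\!\int \cos ((x - y) t) \, d\mu(x) \, d\mu(y).$$
  By Fubini the triangular mean of $|b|^2$ is therefore the integral over $\mu \otimes \mu$ of the
  triangular mean of $t \mapsto \cos (u t)$ at $u = x - y$ (\<open>triangular_char_mean_eq\<close>).  The
  latter is a Fejer kernel: it is bounded by $1$, equals $1$ at $u = 0$, and tends to $0$ as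
  $T \to \infty$ for every $u \neq 0$.  Dominated convergence then leaves the mass that
  $\mu \otimes \mu$ gives to the diagonal (\<open>triangular_char_mean_tendsto_diagonal\<close>), which
  is carried by the points $(x, x)$ with $x$ an atom of $\mu$ and so equals the sum of the squared
  atoms (\<open>has_sum_atoms_diagonal\<close>).

  The atoms of $\mu$ are the jumps of $\vartheta$ (\<open>measure_stieltjes_measure_singleton\<close>), so the
  limit is $\sum_\alpha m_\alpha^2$ for every spectral distribution function of the process, stable
  or not.  If some spectral distribution function is continuous, the limit computed with it is an
  empty sum.  Conversely, if the limit vanishes, every jump of the given $\vartheta$ is $0$, and a
  monotone function without jumps is continuous.  Uniqueness of the spectral measure is thus
  replaced by uniqueness of the limit.\<close>

section \<open>Triangular means of cosines\<close>

lemma triangular_cos_mean_eq: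
  fixes T u :: real
  assumes "T > 0"
  shows "2 / T * (LBINT t:{0..T}. (1 - t / T) * cos (u * t)) =
    (if u = 0 then 1 else 2 * (1 - cos (u * T)) / (u * T)\<^sup>2)"
proof (cases "u = 0")
  case True
  have "(LBINT t:{0..T}. (1 - t / T) * cos (u * t)) = (T - T\<^sup>2 / (2 * T)) - (0 - 0\<^sup>2 / (2 * T))"
    unfolding set_lebesgue_integral_def
    by (rule integral_FTC_Icc)
       (use assms True in \<open>auto intro!: derivative_eq_intros continuous_intros
          simp flip: has_real_derivative_iff_has_vector_derivative\<close>)
  then show ?thesis
    using assms True by (simp add: power2_eq_square)
next
  case False
  \<comment> \<open>an antiderivative, found by integrating by parts once\<close>
  define G where "G = (\<lambda>t. (1 - t / T) * sin (u * t) / u - cos (u * t) / (T * u\<^sup>2))"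
  have "(LBINT t:{0..T}. (1 - t / T) * cos (u * t)) = G T - G 0"
    unfolding set_lebesgue_integral_def
  proof (rule integral_FTC_Icc)
    show "(G has_vector_derivative (1 - t / T) * cos (u * t)) (at t within {0..T})" for t
      unfolding G_def has_real_derivative_iff_has_vector_derivative[symmetric] using assms False
      by (auto intro!: derivative_eq_intros simp: field_simps power2_eq_square)
    show "continuous_on {0..T} (\<lambda>t. (1 - t / T) * cos (u * t))"
      using assms by (auto intro!: continuous_intros)
  qed (use assms in simp)
  also have "\<dots> = (1 - cos (u * T)) / (T * u\<^sup>2)"
    using assms by (simp add: G_def diff_divide_distrib)
  finally show ?thesis
    using assms False by (simp add: field_simps power2_eq_square)
qed

text \<open>The mean is at most $1$ because $1 - \cos v = 2 \sin^2 (v/2) \le v^2/2$.  The bound is uniform in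
  $u$ and $T$, so that a constant can serve as the dominating function below.\<close>

lemma triangular_cos_mean_bound:
  fixes T u :: real
  assumes "T > 0"
  shows "\<bar>2 / T * (LBINT t:{0..T}. (1 - t / T) * cos (u * t))\<bar> \<le> 1"
proof (cases "u = 0")
  case False
  have "1 - cos (u * T) = 2 * (sin (u * T / 2))\<^sup>2"
    using cos_double_sin[of "u * T / 2"] by simp
  moreover have "(sin (u * T / 2))\<^sup>2 \<le> (u * T / 2)\<^sup>2"
    using abs_sin_x_le_abs_x[of "u * T / 2"] by (simp only: abs_le_square_iff)
  ultimately have "2 * (1 - cos (u * T)) \<le> (u * T)\<^sup>2"
    by (simp add: power_divide)
  then have "\<bar>2 * (1 - cos (u * T)) / (u * T)\<^sup>2\<bar> \<le> 1"
    using cos_le_one[of "u * T"] by (simp add: abs_mult divide_le_eq)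
  then show ?thesis
    unfolding triangular_cos_mean_eq[OF assms] using False by simp
next
  case True
  then show ?thesis
    unfolding triangular_cos_mean_eq[OF assms] by simp
qed

text \<open>This pointwise limit is what isolates the diagonal: with $u = x - y$ it is the indicator of
  $x = y$.\<close>

lemma triangular_cos_mean_tendsto:
  fixes u :: real
  shows "((\<lambda>T. 2 / T * (LBINT t:{0..T}. (1 - t / T) * cos (u * t))) \<longlongrightarrow> of_bool (u = 0)) at_top"
proof -
  have "((\<lambda>T. if u = 0 then 1 else 2 * (1 - cos (u * T)) / (u * T)\<^sup>2) \<longlongrightarrow> of_bool (u = 0)) at_top"
  proof (cases "u = 0")
    case False
    have "((\<lambda>T. 2 * (1 - cos (u * T)) / (u * T)\<^sup>2) \<longlongrightarrow> 0) at_top"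
    proof (rule Lim_null_comparison)
      show "\<forall>\<^sub>F T in at_top. norm (2 * (1 - cos (u * T)) / (u * T)\<^sup>2) \<le> 4 / u\<^sup>2 * inverse (T ^ 2)"
      proof (intro always_eventually allI)
        fix T :: real
        have "\<bar>2 * (1 - c)\<bar> \<le> 4" if "- 1 \<le> c" "c \<le> 1" for c :: real
          using that by simp
        then have "\<bar>2 * (1 - cos (u * T))\<bar> \<le> 4"
          using cos_ge_minus_one cos_le_one by blast
        then have "\<bar>2 * (1 - cos (u * T))\<bar> / (u * T)\<^sup>2 \<le> 4 / (u * T)\<^sup>2"
          by (rule divide_right_mono) simp
        then show "norm (2 * (1 - cos (u * T)) / (u * T)\<^sup>2) \<le> 4 / u\<^sup>2 * inverse (T ^ 2)"
          by (simp add: abs_mult power_mult_distrib divide_simps)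
      qed
      show "((\<lambda>T. 4 / u\<^sup>2 * inverse (T ^ 2)) \<longlongrightarrow> 0) at_top"
        by (rule tendsto_mult_right_zero)
           (auto intro!: tendsto_inverse_0_at_top filterlim_pow_at_top filterlim_ident)
    qed
    then show ?thesis
      using False by simp
  qed simp
  then show ?thesis
    by (rule Lim_transform_eventually)
       (rule eventually_mono[OF eventually_gt_at_top[of "0::real"]], rule triangular_cos_mean_eq[symmetric])
qed

section \<open>Wiener's theorem on the atoms of a finite measure\<close>

context finite_borel_measure
begin

text \<open>The product of the characteristic function with its conjugate is a double integral of
  $e^{i t (x - y)}$; as the left side is real, only the cosine survives.\<close>

lemma cmod_char_power2:
  "(cmod (char M t))\<^sup>2 = (LINT p|(M \<Otimes>\<^sub>M M). cos ((fst p - snd p) * t))"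
proof -
  interpret PP: finite_measure "M \<Otimes>\<^sub>M M"
    by (intro finite_measure_pair_measure finite_measure_axioms)
  interpret P: pair_sigma_finite M M ..
  note M_is_borel[measurable_cong]
  have [measurable]: "cnj \<in> borel_measurable borel"
    by (intro borel_measurable_continuous_onI continuous_intros)
  let ?f = "\<lambda>p. iexp (t * fst p) * cnj (iexp (t * snd p))"
  have int: "integrable (M \<Otimes>\<^sub>M M) ?f"
    by (rule PP.integrable_const_bound[where B = 1]) (auto simp: norm_mult)
  have "complex_of_real ((cmod (char M t))\<^sup>2) = char M t * cnj (char M t)"
    by (rule complex_norm_square)
  also have "\<dots> = (LINT x|M. LINT y|M. ?f (x, y))"
    unfolding char_def by simp
  also have "\<dots> = (LINT p|(M \<Otimes>\<^sub>M M). ?f p)"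
    using P.integral_fst'[OF int] by simp
  finally have "(cmod (char M t))\<^sup>2 = Re (LINT p|(M \<Otimes>\<^sub>M M). ?f p)"
    by (metis Re_complex_of_real)
  also have "\<dots> = (LINT p|(M \<Otimes>\<^sub>M M). Re (?f p))"
    by (rule integral_Re[OF int, symmetric])
  also have "(\<lambda>p. Re (?f p)) = (\<lambda>p. cos ((fst p - snd p) * t))"
    by (auto simp: fun_eq_iff Re_exp Im_exp cos_diff algebra_simps)
  finally show ?thesis .
qed

text \<open>Exchanging the integrals is legitimate because the integrand is bounded by $1$ and vanishes
  outside a set of finite measure, $[0, T]$ times the whole product space.\<close>

lemma triangular_char_mean_eq:
  assumes "T > 0"
  shows "2 / T * (LBINT t:{0..T}. (1 - t / T) * (cmod (char M t))\<^sup>2) =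
    (LINT p|(M \<Otimes>\<^sub>M M). 2 / T * (LBINT t:{0..T}. (1 - t / T) * cos ((fst p - snd p) * t)))"
proof -
  interpret PP: finite_measure "M \<Otimes>\<^sub>M M"
    by (intro finite_measure_pair_measure finite_measure_axioms)
  interpret P: pair_sigma_finite lborel "M \<Otimes>\<^sub>M M" ..
  note M_is_borel[measurable_cong]
  let ?g = "\<lambda>t p. indicator {0..T} t *\<^sub>R ((1 - t / T) * cos ((fst p - snd p) * t)) :: real"
  have int: "integrable (lborel \<Otimes>\<^sub>M (M \<Otimes>\<^sub>M M)) (case_prod ?g)"
  proof (rule integrableI_bounded_set[where A = "{0..T} \<times> space (M \<Otimes>\<^sub>M M)" and B = 1])
    show "emeasure (lborel \<Otimes>\<^sub>M (M \<Otimes>\<^sub>M M)) ({0..T} \<times> space (M \<Otimes>\<^sub>M M)) < \<infinity>"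
      using assms PP.emeasure_finite[of "space (M \<Otimes>\<^sub>M M)"]
      by (simp add: PP.emeasure_pair_measure_Times ennreal_mult_eq_top_iff less_top[symmetric])
    have "\<bar>(1 - t / T) * cos v\<bar> \<le> 1" if "0 \<le> t" "t \<le> T" for t v :: real
    proof -
      have "\<bar>1 - t / T\<bar> * \<bar>cos v\<bar> \<le> 1 * 1"
        using that assms by (intro mult_mono) (auto simp: field_simps)
      then show ?thesis
        by (simp add: abs_mult)
    qed
    then show "AE x in lborel \<Otimes>\<^sub>M (M \<Otimes>\<^sub>M M). x \<in> {0..T} \<times> space (M \<Otimes>\<^sub>M M) \<longrightarrow> norm (case_prod ?g x) \<le> 1"
      by auto
    show "AE x in lborel \<Otimes>\<^sub>M (M \<Otimes>\<^sub>M M). x \<notin> {0..T} \<times> space (M \<Otimes>\<^sub>M M) \<longrightarrow> case_prod ?g x = 0"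
      by (intro AE_I2) (simp add: space_pair_measure split_beta mem_Times_iff indicator_def)
  qed auto
  have "(LBINT t:{0..T}. (1 - t / T) * (cmod (char M t))\<^sup>2) = (LINT t|lborel. LINT p|(M \<Otimes>\<^sub>M M). ?g t p)"
    by (simp add: set_lebesgue_integral_def cmod_char_power2)
  also have "\<dots> = (LINT p|(M \<Otimes>\<^sub>M M). LINT t|lborel. ?g t p)"
    by (rule P.Fubini_integral[OF int, symmetric])
  finally show ?thesis
    by (simp add: set_lebesgue_integral_def)
qed

lemma triangular_char_mean_tendsto_diagonal:
  "((\<lambda>T. 2 / T * (LBINT t:{0..T}. (1 - t / T) * (cmod (char M t))\<^sup>2))
     \<longlongrightarrow> measure (M \<Otimes>\<^sub>M M) {p. fst p = snd p}) at_top"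
proof -
  interpret PP: finite_measure "M \<Otimes>\<^sub>M M"
    by (intro finite_measure_pair_measure finite_measure_axioms)
  note M_is_borel[measurable_cong]
  have [simp]: "space (M \<Otimes>\<^sub>M M) = UNIV"
    using sets_eq_imp_space_eq[OF M_is_borel] by (simp add: space_pair_measure)
  let ?K = "\<lambda>T p. 2 / T * (LBINT t:{0..T}. (1 - t / T) * cos ((fst p - snd p) * t))"
  have "((\<lambda>T. LINT p|(M \<Otimes>\<^sub>M M). ?K T p) \<longlongrightarrow> (LINT p|(M \<Otimes>\<^sub>M M). of_bool (fst p - snd p = 0))) at_top"
  proof (rule integral_dominated_convergence_at_top[where w = "\<lambda>_. 1"])
    show "\<forall>\<^sub>F T in at_top. AE p in M \<Otimes>\<^sub>M M. norm (?K T p) \<le> 1"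
      using eventually_gt_at_top[of "0::real"]
      by eventually_elim (intro AE_I2, simp only: real_norm_def triangular_cos_mean_bound)
    show "AE p in M \<Otimes>\<^sub>M M. ((\<lambda>T. ?K T p) \<longlongrightarrow> of_bool (fst p - snd p = 0)) at_top"
      by (intro AE_I2 triangular_cos_mean_tendsto)
    show "?K T \<in> borel_measurable (M \<Otimes>\<^sub>M M)" for T
      unfolding set_lebesgue_integral_def by measurable
  qed auto
  also have "(LINT p|(M \<Otimes>\<^sub>M M). of_bool (fst p - snd p = 0)) =
      (LINT p|(M \<Otimes>\<^sub>M M). indicator {p. fst p = snd p} p :: real)"
    by (rule Bochner_Integration.integral_cong) (auto simp: indicator_def)
  also have "\<dots> = measure (M \<Otimes>\<^sub>M M) {p. fst p = snd p}"
    by simp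
  finally show ?thesis
    by (rule Lim_transform_eventually)
       (rule eventually_mono[OF eventually_gt_at_top[of "0::real"]], rule triangular_char_mean_eq[symmetric])
qed

text \<open>By Tonelli, the measure of a subset of the product is determined by those of its vertical
  sections.  The section of the diagonal over $x$ is the point $x$, which has measure $0$ unless
  $x \in D$; so the diagonal may be replaced by its countably many points over $D$, where countable
  additivity applies.\<close>

lemma has_sum_atoms_diagonal:
  assumes "countable D" and atoms: "\<And>x. x \<notin> D \<Longrightarrow> measure M {x} = 0"
  shows "((\<lambda>x. (measure M {x})\<^sup>2) has_sum measure (M \<Otimes>\<^sub>M M) {p. fst p = snd p}) D"
proof -
  interpret PP: finite_measure "M \<Otimes>\<^sub>M M"
    by (intro finite_measure_pair_measure finite_measure_axioms)
  note M_is_borel[measurable_cong]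
  have [simp]: "space (M \<Otimes>\<^sub>M M) = UNIV"
    using sets_eq_imp_space_eq[OF M_is_borel] by (simp add: space_pair_measure)
  have \<Delta>: "{p. fst p = snd p} \<in> sets (M \<Otimes>\<^sub>M M)"
  proof -
    have "{p \<in> space (M \<Otimes>\<^sub>M M). fst p = snd p} \<in> sets (M \<Otimes>\<^sub>M M)"
      by measurable
    then show ?thesis by simp
  qed
  have point: "{(x, x)} \<in> sets (M \<Otimes>\<^sub>M M)" for x
    using pair_measureI[of "{x}" M "{x}" M] by (simp add: sets_M)
  have \<Delta>D: "(\<Union>x\<in>D. {(x, x)}) \<in> sets (M \<Otimes>\<^sub>M M)"
    using \<open>countable D\<close> point by (intro sets.countable_UN') auto
  have "emeasure (M \<Otimes>\<^sub>M M) {p. fst p = snd p} = emeasure (M \<Otimes>\<^sub>M M) (\<Union>x\<in>D. {(x, x)})"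
    unfolding emeasure_pair_measure_alt[OF \<Delta>] emeasure_pair_measure_alt[OF \<Delta>D]
  proof (rule nn_integral_cong)
    fix x :: real
    have "Pair x -` {p. fst p = snd p} = {x}"
      by auto
    moreover have "Pair x -` (\<Union>y\<in>D. {(y, y)}) = (if x \<in> D then {x} else {})"
      by auto
    ultimately show "emeasure M (Pair x -` {p. fst p = snd p}) = emeasure M (Pair x -` (\<Union>y\<in>D. {(y, y)}))"
      using atoms[of x] by (simp add: emeasure_eq_measure)
  qed
  also have "\<dots> = (\<integral>\<^sup>+x. emeasure (M \<Otimes>\<^sub>M M) {(x, x)} \<partial>count_space D)"
    by (rule emeasure_UN_countable) (auto simp: point \<open>countable D\<close> disjoint_family_on_def)
  also have "\<dots> = (\<integral>\<^sup>+x. ennreal ((measure M {x})\<^sup>2) \<partial>count_space D)"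
  proof (rule nn_integral_cong)
    fix x :: real
    have "emeasure (M \<Otimes>\<^sub>M M) ({x} \<times> {x}) = emeasure M {x} * emeasure M {x}"
      by (rule emeasure_pair_measure_Times) (auto simp: sets_M)
    then show "emeasure (M \<Otimes>\<^sub>M M) {(x, x)} = ennreal ((measure M {x})\<^sup>2)"
      by (simp add: emeasure_eq_measure power2_eq_square ennreal_mult)
  qed
  \<comment> \<open>the right side is finite, so this one identity gives both summability and the sum\<close>
  finally have eq: "(\<integral>\<^sup>+x. ennreal ((measure M {x})\<^sup>2) \<partial>count_space D) =
      ennreal (measure (M \<Otimes>\<^sub>M M) {p. fst p = snd p})"
    by (simp add: PP.emeasure_eq_measure)
  then have "integrable (count_space D) (\<lambda>x. (measure M {x})\<^sup>2)"
    by (intro integrableI_bounded) auto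
  then have abs: "Infinite_Set_Sum.abs_summable_on (\<lambda>x. (measure M {x})\<^sup>2) D"
    by (simp add: abs_summable_on_def)
  have "infsetsum (\<lambda>x. (measure M {x})\<^sup>2) D = measure (M \<Otimes>\<^sub>M M) {p. fst p = snd p}"
    unfolding infsetsum_def by (subst integral_eq_nn_integral) (auto simp: eq)
  moreover have "(\<lambda>x. (measure M {x})\<^sup>2) summable_on D"
    using abs abs_summable_equivalent[of "\<lambda>x. (measure M {x})\<^sup>2" D] by simp
  ultimately show ?thesis
    using infsetsum_infsum[OF abs] by (metis has_sum_infsum)
qed

theorem triangular_char_mean_tendsto_atoms:
  assumes "countable D" "\<And>x. x \<notin> D \<Longrightarrow> measure M {x} = 0"
  shows "(\<lambda>x. (measure M {x})\<^sup>2) summable_on D"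
    and "((\<lambda>T. 2 / T * (LBINT t:{0..T}. (1 - t / T) * (cmod (char M t))\<^sup>2))
           \<longlongrightarrow> (\<Sum>\<^sub>\<infinity>x\<in>D. (measure M {x})\<^sup>2)) at_top"
  using has_sum_atoms_diagonal[OF assms] triangular_char_mean_tendsto_diagonal
  by (auto simp: infsumI dest: has_sum_imp_summable)

end

section \<open>The measure of a bounded non-decreasing function\<close>

context
  fixes \<theta> :: "real \<Rightarrow> real"
  assumes mono: "mono \<theta>" and bdd: "bounded (range \<theta>)"
begin

lemma tendsto_Lim_at_left: "(\<theta> \<longlongrightarrow> Lim (at_left x) \<theta>) (at_left x)"
proof -
  obtain K where "\<And>y. \<bar>\<theta> y\<bar> \<le> K"
    using bdd by (auto simp: bounded_iff)
  then have "(\<theta> \<longlongrightarrow> Sup (\<theta> ` ({..<x} \<inter> UNIV))) (at x within ({..<x} \<inter> UNIV))"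
    using mono by (intro Lim_left_bound[where K = K]) (auto simp: mono_def abs_le_iff)
  then show ?thesis
    using tendsto_Lim[of "at_left x" \<theta>] by auto
qed

lemma tendsto_Lim_at_right: "(\<theta> \<longlongrightarrow> Lim (at_right x) \<theta>) (at_right x)"
proof -
  obtain K where "\<And>y. \<bar>\<theta> y\<bar> \<le> K"
    using bdd by (auto simp: bounded_iff)
  then have "- K \<le> \<theta> y" for y
    using abs_le_D2 minus_le_iff by blast
  then have "(\<theta> \<longlongrightarrow> Inf (\<theta> ` ({x<..} \<inter> UNIV))) (at x within ({x<..} \<inter> UNIV))"
    using mono by (intro Lim_right_bound[where K = "- K"]) (auto simp: mono_def)
  then show ?thesis
    using tendsto_Lim[of "at_right x" \<theta>] by auto
qed

lemma Lim_at_right_le: "x < y \<Longrightarrow> Lim (at_right x) \<theta> \<le> \<theta> y"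
  by (rule tendsto_upperbound[OF tendsto_Lim_at_right])
     (auto intro!: eventually_mono[OF eventually_at_right_real[of x y]] monoD[OF mono])

lemma le_Lim_at_right: "\<theta> x \<le> Lim (at_right x) \<theta>"
  by (rule tendsto_lowerbound[OF tendsto_Lim_at_right])
     (auto intro!: eventually_mono[OF eventually_at_right_real[of x "x + 1"]] monoD[OF mono])

lemma le_Lim_at_left: "x < y \<Longrightarrow> \<theta> x \<le> Lim (at_left y) \<theta>"
  by (rule tendsto_lowerbound[OF tendsto_Lim_at_left])
     (auto intro!: eventually_mono[OF eventually_at_left_real[of x y]] monoD[OF mono])

lemma Lim_at_left_le: "Lim (at_left x) \<theta> \<le> \<theta> x"
  by (rule tendsto_upperbound[OF tendsto_Lim_at_left])
     (auto intro!: eventually_mono[OF eventually_at_left_real[of "x - 1" x]] monoD[OF mono])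

lemma mono_Lim_at_right: "x \<le> y \<Longrightarrow> Lim (at_right x) \<theta> \<le> Lim (at_right y) \<theta>"
  using Lim_at_right_le[of x y] le_Lim_at_right[of y] by (cases "x = y") auto

text \<open>Passing to right limits keeps monotonicity and makes the function right-continuous: near $a$, the
  value $\vartheta(x+0)$ is below $\vartheta(z)$ for a slightly larger $z$, which is close to
  $\vartheta(a+0)$.  Both properties are required for interval measures.\<close>

lemma continuous_at_right_Lim_at_right: "continuous (at_right a) (\<lambda>x. Lim (at_right x) \<theta>)"
  unfolding continuous_within
proof (rule order_tendstoI)
  fix c assume "c < Lim (at_right a) \<theta>"
  then show "\<forall>\<^sub>F x in at_right a. c < Lim (at_right x) \<theta>"
    using eventually_at_right_less[of a]
    by (auto elim!: eventually_mono intro: less_le_trans mono_Lim_at_right less_imp_le)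
next
  fix c assume "Lim (at_right a) \<theta> < c"
  then have "\<forall>\<^sub>F x in at_right a. \<theta> x < c"
    using tendsto_Lim_at_right order_tendstoD(2) by blast
  then obtain d where "a < d" and d: "\<And>x. a < x \<Longrightarrow> x < d \<Longrightarrow> \<theta> x < c"
    unfolding eventually_at_right_field by auto
  have "Lim (at_right x) \<theta> < c" if "x \<in> {a<..<d}" for x
  proof -
    have "x < d"
      using that by simp
    from dense[OF this] obtain z where "x < z" "z < d"
      by blast
    then show ?thesis
      using that d[of z] Lim_at_right_le[of x z] by auto
  qed
  then show "\<forall>\<^sub>F x in at_right a. Lim (at_right x) \<theta> < c"
    using eventually_at_right_real[OF \<open>a < d\<close>] by (auto elim: eventually_mono)
qed

text \<open>The right-continuous version has the same left limits as $\vartheta$, hence the same jumps,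
  whatever values $\vartheta$ takes at its discontinuities.\<close>

lemma tendsto_at_left_Lim_at_right:
  "((\<lambda>x. Lim (at_right x) \<theta>) \<longlongrightarrow> Lim (at_left a) \<theta>) (at_left a)"
proof (rule tendsto_sandwich[OF _ _ tendsto_Lim_at_left tendsto_const])
  show "\<forall>\<^sub>F x in at_left a. \<theta> x \<le> Lim (at_right x) \<theta>"
    by (simp add: le_Lim_at_right)
  have "Lim (at_right x) \<theta> \<le> Lim (at_left a) \<theta>" if "x < a" for x
  proof -
    obtain z where "x < z" "z < a"
      using dense[OF \<open>x < a\<close>] by auto
    then show ?thesis
      using Lim_at_right_le[of x z] le_Lim_at_left[of z a] by auto
  qed
  then show "\<forall>\<^sub>F x in at_left a. Lim (at_right x) \<theta> \<le> Lim (at_left a) \<theta>"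
    by (auto intro: eventually_mono[OF eventually_at_left_real[of "a - 1" a]])
qed

lemma emeasure_stieltjes_measure_Ioc:
  "x \<le> y \<Longrightarrow> emeasure (stieltjes_measure \<theta>) {x<..y} =
     ennreal (Lim (at_right y) \<theta> - Lim (at_right x) \<theta>)"
  unfolding stieltjes_measure_def
  by (rule emeasure_interval_measure_Ioc)
     (auto simp: mono_Lim_at_right continuous_at_right_Lim_at_right)

lemma finite_borel_measure_stieltjes_measure: "finite_borel_measure (stieltjes_measure \<theta>)"
proof -
  obtain K where K: "\<And>y. \<bar>\<theta> y\<bar> \<le> K"
    using bdd by (auto simp: bounded_iff)
  let ?A = "\<lambda>n::nat. {- real n<..real n}"
  have "(SUP n. emeasure (stieltjes_measure \<theta>) (?A n)) = emeasure (stieltjes_measure \<theta>) (\<Union>n. ?A n)"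
    by (rule SUP_emeasure_incseq) (auto simp: stieltjes_measure_def incseq_def)
  moreover have "(\<Union>n. ?A n) = UNIV"
  proof -
    have "\<exists>n. x \<in> ?A n" for x
    proof -
      obtain n where "\<bar>x\<bar> < real n"
        using reals_Archimedean2 by blast
      then show ?thesis
        by (intro exI[of _ n]) (simp add: abs_less_iff)
    qed
    then show ?thesis by auto
  qed
  moreover have "emeasure (stieltjes_measure \<theta>) (?A n) \<le> ennreal (2 * K)" for n
  proof -
    have "Lim (at_right (real n)) \<theta> \<le> K" "- K \<le> Lim (at_right (- real n)) \<theta>"
      using Lim_at_right_le[of "real n" "real n + 1"] K[of "real n + 1"]
        le_Lim_at_right[of "- real n"] K[of "- real n"] by (auto simp: abs_le_iff)
    then show ?thesis
      by (subst emeasure_stieltjes_measure_Ioc) (auto intro!: ennreal_leI)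
  qed
  ultimately have "emeasure (stieltjes_measure \<theta>) UNIV \<le> ennreal (2 * K)"
    using SUP_least[of UNIV "\<lambda>n. emeasure (stieltjes_measure \<theta>) (?A n)" "ennreal (2 * K)"] by simp
  then have "finite_measure (stieltjes_measure \<theta>)"
    by (intro finite_measureI) (auto simp: stieltjes_measure_def top_unique)
  then show ?thesis
    by (simp add: finite_borel_measure_def finite_borel_measure_axioms_def stieltjes_measure_def)
qed

text \<open>The distribution function of the measure and $\vartheta(x+0)$ have the same increments, and the
  left limit of a distribution function at $x$ is the measure of the open half-line below $x$.\<close>

lemma measure_stieltjes_measure_singleton: "measure (stieltjes_measure \<theta>) {x} = jump \<theta> x"
proof -
  interpret finite_borel_measure "stieltjes_measure \<theta>"
    by (rule finite_borel_measure_stieltjes_measure)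
  let ?c = "cdf (stieltjes_measure \<theta>)"
  have cdf: "?c x - (Lim (at_right x) \<theta> - Lim (at_right y) \<theta>) = ?c y" if "y < x" for y
    using cdf_diff_eq[OF that] emeasure_stieltjes_measure_Ioc[of y x] that
      mono_Lim_at_right[of y x]
    by (simp add: measure_def)
  have "((\<lambda>y. ?c x - (Lim (at_right x) \<theta> - Lim (at_right y) \<theta>)) \<longlongrightarrow> ?c x - jump \<theta> x) (at_left x)"
    unfolding jump_def by (intro tendsto_intros tendsto_at_left_Lim_at_right)
  then have "(?c \<longlongrightarrow> ?c x - jump \<theta> x) (at_left x)"
    by (rule Lim_transform_eventually)
       (auto intro!: eventually_mono[OF eventually_at_left_real[of "x - 1" x]] cdf)
  then have "measure (stieltjes_measure \<theta>) {..<x} = ?c x - jump \<theta> x"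
    using cdf_at_left[of x] by (intro tendsto_unique[of "at_left x"]) auto
  moreover have "measure (stieltjes_measure \<theta>) ({..<x} \<union> {x}) =
      measure (stieltjes_measure \<theta>) {..<x} + measure (stieltjes_measure \<theta>) {x}"
    by (rule finite_measure_Union) (auto simp: sets_M)
  moreover have "{..<x} \<union> {x} = {..x}"
    by auto
  ultimately show ?thesis
    by (simp add: cdf_def)
qed

text \<open>By monotonicity $\vartheta(x)$ lies between the one-sided limits, so a vanishing jump rules out
  removable discontinuities as well.\<close>

lemma jump_eq_0_iff_isCont: "jump \<theta> x = 0 \<longleftrightarrow> isCont \<theta> x"
proof
  assume "jump \<theta> x = 0"
  then have "Lim (at_left x) \<theta> = \<theta> x" "Lim (at_right x) \<theta> = \<theta> x"
    using Lim_at_left_le[of x] le_Lim_at_right[of x] by (auto simp: jump_def)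
  then show "isCont \<theta> x"
    using tendsto_Lim_at_left[of x] tendsto_Lim_at_right[of x]
    by (simp add: isCont_def filterlim_at_split)
next
  assume "isCont \<theta> x"
  then have "(\<theta> \<longlongrightarrow> \<theta> x) (at_left x)" "(\<theta> \<longlongrightarrow> \<theta> x) (at_right x)"
    by (simp_all add: isCont_def filterlim_at_split)
  then show "jump \<theta> x = 0"
    by (simp add: jump_def tendsto_Lim)
qed

text \<open>Since this holds for every function that represents $b$, it can be applied both to a given
  $\vartheta$ and to a continuous one, and the two limits compared.\<close>

lemma triangular_stieltjes_mean_tendsto_jumps:
  assumes b: "\<And>t. b t = (LINT x|stieltjes_measure \<theta>. exp (\<i> * of_real (x * t)))"
  shows "(\<lambda>x. (jump \<theta> x)\<^sup>2) summable_on discontinuities \<theta>"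
    and "((\<lambda>T. 2 / T * (LBINT t:{0..T}. (1 - t / T) * (cmod (b t))\<^sup>2))
           \<longlongrightarrow> (\<Sum>\<^sub>\<infinity>x\<in>discontinuities \<theta>. (jump \<theta> x)\<^sup>2)) at_top"
proof -
  interpret finite_borel_measure "stieltjes_measure \<theta>"
    by (rule finite_borel_measure_stieltjes_measure)
  have "b = char (stieltjes_measure \<theta>)"
    by (simp add: fun_eq_iff b char_def mult.commute)
  moreover have "countable (discontinuities \<theta>)"
    unfolding discontinuities_def using mono by (rule mono_ctble_discont)
  moreover have "measure (stieltjes_measure \<theta>) {x} = 0" if "x \<notin> discontinuities \<theta>" for x
    using that by (simp add: measure_stieltjes_measure_singleton jump_eq_0_iff_isCont discontinuities_def)
  ultimately show "(\<lambda>x. (jump \<theta> x)\<^sup>2) summable_on discontinuities \<theta>"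
    and "((\<lambda>T. 2 / T * (LBINT t:{0..T}. (1 - t / T) * (cmod (b t))\<^sup>2))
           \<longlongrightarrow> (\<Sum>\<^sub>\<infinity>x\<in>discontinuities \<theta>. (jump \<theta> x)\<^sup>2)) at_top"
    using triangular_char_mean_tendsto_atoms[of "discontinuities \<theta>"]
    by (simp_all add: measure_stieltjes_measure_singleton)
qed

lemma infsum_jumps_eq_0_imp_continuous:
  assumes "(\<lambda>x. (jump \<theta> x)\<^sup>2) summable_on discontinuities \<theta>"
    and "(\<Sum>\<^sub>\<infinity>x\<in>discontinuities \<theta>. (jump \<theta> x)\<^sup>2) = 0"
  shows "continuous_on UNIV \<theta>"
proof -
  have "isCont \<theta> x" for x
  proof (rule ccontr)
    assume "\<not> isCont \<theta> x"
    moreover from this have "(jump \<theta> x)\<^sup>2 = 0"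
      using nonneg_infsum_le_0D[of "\<lambda>x. (jump \<theta> x)\<^sup>2" "discontinuities \<theta>" x] assms
      by (auto simp: discontinuities_def)
    ultimately show False
      by (simp add: jump_eq_0_iff_isCont)
  qed
  then show ?thesis
    by (simp add: continuous_on_eq_continuous_at)
qed

end

section \<open>The stability criterion\<close>

theorem theorem4p1:
  fixes M :: "'w measure" and \<xi> :: "real \<Rightarrow> 'w \<Rightarrow> complex"
    and b :: "real \<Rightarrow> complex" and \<theta> :: "real \<Rightarrow> real"
  assumes "stationary_process M \<xi>"
    and "b = correlation_function M \<xi>"
    and "continuous_on UNIV b"
    and "spectral_distribution_function M \<xi> \<theta>"
  shows "(stable_process M \<xi> \<longleftrightarrow>
           ((\<lambda>T::real. 2 / T * (LBINT t:{0..T}. (1 - t / T) * (cmod (b t))\<^sup>2)) \<longlongrightarrow> 0) at_top)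
       \<and> (\<not> stable_process M \<xi> \<longrightarrow>
           (\<lambda>x. (jump \<theta> x)\<^sup>2) summable_on discontinuities \<theta> \<and>
           ((\<lambda>T::real. 2 / T * (LBINT t:{0..T}. (1 - t / T) * (cmod (b t))\<^sup>2)) \<longlongrightarrow>
              (\<Sum>\<^sub>\<infinity>x\<in>discontinuities \<theta>. (jump \<theta> x)\<^sup>2)) at_top)"
proof -
  let ?m = "\<lambda>T::real. 2 / T * (LBINT t:{0..T}. (1 - t / T) * (cmod (b t))\<^sup>2)"
  have limit: "(\<lambda>x. (jump \<eta> x)\<^sup>2) summable_on discontinuities \<eta>"
      "(?m \<longlongrightarrow> (\<Sum>\<^sub>\<infinity>x\<in>discontinuities \<eta>. (jump \<eta> x)\<^sup>2)) at_top"
    if "spectral_distribution_function M \<xi> \<eta>" for \<eta>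
    using triangular_stieltjes_mean_tendsto_jumps[of \<eta> b] that assms(2)
    by (simp_all add: spectral_distribution_function_def)
  have "(?m \<longlongrightarrow> 0) at_top" if stable: "stable_process M \<xi>"
  proof -
    obtain \<eta> where "spectral_distribution_function M \<xi> \<eta>" "continuous_on UNIV \<eta>"
      using stable unfolding stable_process_def by blast
    moreover from this have "discontinuities \<eta> = {}"
      by (simp add: discontinuities_def continuous_on_eq_continuous_at)
    ultimately show ?thesis
      using limit(2)[of \<eta>] by simp
  qed
  moreover have "stable_process M \<xi>" if "(?m \<longlongrightarrow> 0) at_top"
  proof -
    have "(\<Sum>\<^sub>\<infinity>x\<in>discontinuities \<theta>. (jump \<theta> x)\<^sup>2) = 0"
      using that limit(2)[OF assms(4)] by (intro tendsto_unique[of at_top ?m]) auto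
    then have "continuous_on UNIV \<theta>"
      using infsum_jumps_eq_0_imp_continuous[of \<theta>] limit(1)[OF assms(4)] assms(4)
      by (simp add: spectral_distribution_function_def)
    then show ?thesis
      using assms(4) unfolding stable_process_def by blast
  qed
  ultimately show ?thesis
    using limit[OF assms(4)] by blast
qed

end
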